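(* Let $N\ge 2$ and $\alpha\in(0,1)$. Let $P$ be the transfer operator of the discrete cat map $T_N$ on $X_N=(\mathbb{Z}/N\mathbb{Z})^2$, and let $\widetilde{u}_N(x)=[(I-\alpha P)^{-1}]_{x,x}$. Then $$\widetilde{u}_N(0)-\widetilde{u}_N(x)\;\ge\;\frac{1}{1-\alpha}-\frac{1}{1-\alpha^2}=\frac{\alpha(1+\alpha)}{(1-\alpha)(1-\alpha^2)}\;\longrightarrow\;+\infty\quad\text{as }\alpha\to1^-$$ for all $x\in X_N$ with $x\neq 0$.
   Context: $A=\begin{pmatrix}1&1\\1&2\end{pmatrix}$, and $T_N(x)=Ax \bmod N$ on $X_N$ (a bijection). The transfer operator acts on functions $f:X_N\to\mathbb{C}$ by $(Pf)(x)=f(A^{-1}x \bmod N)$; operators are identified with matrices indexed by $X_N\times X_N$.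
   Formalization: The printed closed form α(1+α)/((1-α)(1-α²)) is false (at α=1/2 the two sides are 2/3 and 2); the formal statement uses the correct α(1-α)/((1-α)(1-α²)) in the equality and in the divergence as α→1⁻. *)

theory Defs
  imports "HOL-Analysis.Analysis" "Berlekamp_Zassenhaus.Finite_Field"
begin

text \<open>
  The modulus is \<open>N = CARD('n)\<close>: for \<open>'n :: nontriv\<close>, i.e. \<open>N \<ge> 2\<close>, the type
  \<open>'n mod_ring\<close> is the ring of integers modulo \<open>N\<close>. The phase space is a type as well, so it
  can serve as index type of vectors and matrices: a function from the phase space to the
  complex numbers is a vector \<open>f :: complex ^ 'n torus\<close> with values \<open>f $ x\<close>.
\<close>

type_synonym 'n torus = "'n mod_ring ^ 2"

definition cat_matrix :: "int ^ 2 ^ 2" where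
  "cat_matrix = vector [vector [1, 1], vector [1, 2]]"

definition mult_mod :: "int ^ 2 ^ 2 \<Rightarrow> 'n::nontriv torus \<Rightarrow> 'n torus" where
  "mult_mod M x = (\<chi> i j. of_int (M $ i $ j)) *v x"

definition cat_map :: "'n::nontriv torus \<Rightarrow> 'n torus" where
  "cat_map x = mult_mod cat_matrix x"

definition transfer_operator :: "complex ^ 'n::nontriv torus \<Rightarrow> complex ^ 'n torus" where
  "transfer_operator f = (\<chi> x. f $ mult_mod (matrix_inv cat_matrix) x)"

definition transfer_matrix :: "complex ^ 'n::nontriv torus ^ 'n torus" where
  "transfer_matrix = matrix transfer_operator"

text \<open>
  \<open>matrix_inv\<close> is a genuine two-sided inverse only for invertible arguments.
\<close>

definition resolvent :: "real \<Rightarrow> complex ^ 'n::nontriv torus ^ 'n torus" where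
  "resolvent \<alpha> = matrix_inv (mat 1 - \<alpha> *\<^sub>R transfer_matrix)"

definition u_tilde :: "real \<Rightarrow> 'n::nontriv torus \<Rightarrow> complex" where
  "u_tilde \<alpha> x = resolvent \<alpha> $ x $ x"

text \<open>
  The integer matrix is invertible over the integers, and multiplication by its inverse
  modulo \<open>N\<close> inverts the cat map.
\<close>

lemma invertible_cat_matrix: "invertible cat_matrix"
  unfolding invertible_def
  by (rule exI[of _ "vector [vector [2, -1], vector [-1, 1]]"])
     (simp add: cat_matrix_def matrix_matrix_mult_def mat_def vec_eq_iff forall_2 sum_2)

lemma mult_mod_compose: "mult_mod M (mult_mod M' x) = mult_mod (M ** M') x"
  by (simp add: mult_mod_def matrix_vector_mul_assoc)
     (simp add: matrix_matrix_mult_def sum_2)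

lemma mult_mod_one: "mult_mod (mat 1) x = x"
  by (simp add: mult_mod_def mat_def vec_eq_iff matrix_vector_mult_def forall_2 sum_2)

lemma inv_cat_map: "inv_into UNIV cat_map = mult_mod (matrix_inv cat_matrix)"
  and bij_cat_map: "bij cat_map"
proof -
  let ?B = "matrix_inv cat_matrix"
  have B: "cat_matrix ** ?B = mat 1" "?B ** cat_matrix = mat 1"
    using someI_ex[OF invertible_cat_matrix[unfolded invertible_def]]
    by (simp_all add: matrix_inv_def)
  have 1: "cat_map (mult_mod ?B x) = x" "mult_mod ?B (cat_map x) = x" for x
    by (simp_all add: cat_map_def mult_mod_compose B mult_mod_one)
  show "inv_into UNIV cat_map = mult_mod ?B"
    by (rule inv_equality) (rule 1)+
  show "bij cat_map"
    by (rule o_bij[of "mult_mod ?B"]) (simp_all add: fun_eq_iff 1)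
qed

end

theory Submission
  imports Defs "HOL-Real_Asymp.Real_Asymp"
begin

text \<open>
  By the Neumann series, the diagonal entry of the resolvent at \<open>x\<close> is the sum of \<open>\<alpha> ^ k\<close> over
  the return times \<open>k\<close> of \<open>x\<close>. At the fixed point \<open>0\<close> every \<open>k\<close> is a return time. The matrix
  \<open>A - I\<close> has determinant \<open>- 1\<close>, so no other point is fixed modulo \<open>N\<close>; hence two consecutive
  integers are never both return times of \<open>x \<noteq> 0\<close>, and the sum is at most \<open>1 / (1 - \<alpha>\<^sup>2)\<close>.
\<close>

text \<open>Entry \<open>(x, y)\<close> of the Neumann series for the operator sending
  \<open>f\<close> to \<open>f\<close> composed with \<open>\<sigma>\<close>: its
  \<open>k\<close>-th power has entry 1 there exactly when
  \<open>(\<sigma> ^^ k) x = y\<close>.\<close>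

definition visit_sum :: "('a \<Rightarrow> 'a) \<Rightarrow> real \<Rightarrow> 'a \<Rightarrow> 'a \<Rightarrow> real" where
  "visit_sum \<sigma> a x y = (\<Sum>k. a ^ k * of_bool ((\<sigma> ^^ k) x = y))"

lemma summable_visit_sum:
  fixes a :: real
  assumes "0 < a" "a < 1"
  shows "summable (\<lambda>k. a ^ k * of_bool ((\<sigma> ^^ k) x = y))"
proof (rule summable_comparison_test')
  show "summable (\<lambda>k. a ^ k)" using assms by (simp add: summable_geometric)
  show "norm (a ^ k * of_bool ((\<sigma> ^^ k) x = y)) \<le> a ^ k" if "k \<ge> 0" for k
    using assms by simp
qed

text \<open>Splitting off the term \<open>k = 0\<close> and shifting the rest by one step gives the
  entrywise form of the resolvent equation.\<close>

lemma visit_sum_rec: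
  assumes "0 < a" "a < 1"
  shows "visit_sum \<sigma> a x y = of_bool (x = y) + a * visit_sum \<sigma> a (\<sigma> x) y"
proof -
  have "visit_sum \<sigma> a x y
      = (\<Sum>k. a ^ Suc k * of_bool ((\<sigma> ^^ Suc k) x = y)) + of_bool (x = y)"
    unfolding visit_sum_def
    using suminf_split_head[OF summable_visit_sum[OF assms, of \<sigma> x y]] by simp
  also have "(\<Sum>k. a ^ Suc k * of_bool ((\<sigma> ^^ Suc k) x = y))
      = (\<Sum>k. a * (a ^ k * of_bool ((\<sigma> ^^ k) (\<sigma> x) = y)))"
    by (simp only: funpow_Suc_right comp_apply power_Suc mult.assoc)
  also have "\<dots> = a * visit_sum \<sigma> a (\<sigma> x) y"
    unfolding visit_sum_def by (rule suminf_mult[OF summable_visit_sum[OF assms]])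
  finally show ?thesis by simp
qed

lemma visit_sum_fixed_point:
  assumes "0 < a" "a < 1" "\<sigma> x = x"
  shows "visit_sum \<sigma> a x x = 1 / (1 - a)"
  using visit_sum_rec[OF assms(1,2), of \<sigma> x x] assms by (simp add: field_simps)

lemma visit_sum_not_fixed_point:
  assumes "0 < a" "a < 1" "\<sigma> x \<noteq> x"
  shows "visit_sum \<sigma> a x x \<le> 1 / (1 - a\<^sup>2)"
proof -
  let ?f = "\<lambda>k. a ^ k * of_bool ((\<sigma> ^^ k) x = x)"
  have s: "summable ?f" by (rule summable_visit_sum[OF assms(1,2)])
  have s': "summable (\<lambda>k. ?f (Suc k))" using s by (subst summable_Suc_iff)
  have g: "summable (\<lambda>k. a ^ k)" using assms by (simp add: summable_geometric)
  have "a * visit_sum \<sigma> a x x = (\<Sum>k. a * ?f k)"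
    unfolding visit_sum_def by (rule suminf_mult[OF s, symmetric])
  also have "\<dots> \<le> (\<Sum>k. a * a ^ k - ?f (Suc k))"
  proof (rule suminf_le)
    \<comment> \<open>If \<open>k\<close> and \<open>k + 1\<close> were both return times, applying
      \<open>\<sigma>\<close> to the first return would give \<open>\<sigma> x = x\<close>. So at
      most one of the two indicators is 1, and both carry the weight
      \<open>a ^ Suc k\<close>.\<close>
    show "a * ?f k \<le> a * a ^ k - ?f (Suc k)" for k
      using assms by auto
  qed (use s s' g in \<open>auto intro!: summable_diff summable_mult simp del: power_Suc funpow.simps\<close>)
  also have "\<dots> = (\<Sum>k. a * a ^ k) - (\<Sum>k. ?f (Suc k))"
    by (rule suminf_diff[symmetric, OF summable_mult[OF g] s'])
  also have "(\<Sum>k. a * a ^ k) = a / (1 - a)"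
    using assms suminf_mult[OF g, of a] suminf_geometric[of a] by simp
  \<comment> \<open>The 1 removed is the return at time 0.\<close>
  also have "(\<Sum>k. ?f (Suc k)) = visit_sum \<sigma> a x x - 1"
    unfolding visit_sum_def using suminf_split_head[OF s] by simp
  finally have "(1 + a) * visit_sum \<sigma> a x x \<le> 1 / (1 - a)"
    using assms by (simp add: field_simps)
  then have "visit_sum \<sigma> a x x \<le> 1 / (1 - a) / (1 + a)"
    using assms by (subst pos_le_divide_eq) (simp_all add: mult.commute)
  also have "\<dots> = 1 / (1 - a\<^sup>2)"
    by (simp add: power2_eq_square algebra_simps)
  finally show ?thesis .
qed

text \<open>For square matrices over a field a right inverse is also a left inverse, hence the only
  inverse that the choice in \<open>matrix_inv\<close> can pick. One product therefore identifies
  the resolvent.\<close>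

lemma matrix_inv_unique_right:
  fixes M R :: "'a::field ^ 'n ^ 'n"
  assumes "M ** R = mat 1"
  shows "invertible M" "matrix_inv M = R"
proof -
  have left: "R ** M = mat 1"
    using assms by (simp add: matrix_left_right_inverse)
  show inv: "invertible M"
    using assms left unfolding invertible_def by blast
  have "M ** matrix_inv M = mat 1"
    using someI_ex[OF inv[unfolded invertible_def]] by (simp add: matrix_inv_def)
  then have "R ** (M ** matrix_inv M) = R" by simp
  then show "matrix_inv M = R" by (simp add: matrix_mul_assoc left)
qed

lemma transfer_matrix_entry:
  "transfer_matrix $ x $ y = of_bool (mult_mod (matrix_inv cat_matrix) x = y)"
  by (simp add: transfer_matrix_def matrix_def transfer_operator_def axis_def)

lemma transfer_neumann_right_inverse:
  fixes a :: real
  assumes "0 < a" "a < 1"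
  shows "(mat 1 - a *\<^sub>R (transfer_matrix :: complex ^ 'n::nontriv torus ^ 'n torus))
    ** (\<chi> x y. of_real (visit_sum (mult_mod (matrix_inv cat_matrix)) a x y)) = mat 1"
    (is "(mat 1 - a *\<^sub>R ?P) ** ?R = mat 1")
proof -
  let ?\<sigma> = "mult_mod (matrix_inv cat_matrix) :: 'n torus \<Rightarrow> _"
  have "((mat 1 - a *\<^sub>R ?P) ** ?R) $ x $ y = mat 1 $ x $ y" for x y
  proof -
    \<comment> \<open>Row \<open>x\<close> is kept as two separate indicator terms, which also
      covers \<open>\<sigma> x = x\<close>, where both sit at the same column.\<close>
    have "((mat 1 - a *\<^sub>R ?P) ** ?R) $ x $ y
        = (\<Sum>z\<in>UNIV. (if x = z then of_real (visit_sum ?\<sigma> a z y) else 0)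
            - (if ?\<sigma> x = z then a *\<^sub>R of_real (visit_sum ?\<sigma> a z y) else 0))"
      unfolding matrix_matrix_mult_def
      by (auto simp: mat_def transfer_matrix_entry scaleR_conv_of_real[where 'a = complex] left_diff_distrib
          intro!: sum.cong)
    also have "\<dots> = of_real (visit_sum ?\<sigma> a x y - a * visit_sum ?\<sigma> a (?\<sigma> x) y)"
      by (simp add: sum_subtractf scaleR_conv_of_real)
    also have "\<dots> = mat 1 $ x $ y"
      using visit_sum_rec[OF assms, of ?\<sigma> x y] by (simp add: mat_def)
    finally show ?thesis .
  qed
  then show ?thesis by (simp add: vec_eq_iff)
qed

text \<open>The first coordinate forces \<open>x $ 2 = 0\<close>, then the second forces
  \<open>x $ 1 = 0\<close>. Only cancellation is involved, so zero divisors for composite moduli do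
  no harm.\<close>

lemma cat_map_fixed_point:
  assumes "cat_map x = x"
  shows "x = 0"
proof -
  have "x $ 1 + x $ 2 = x $ 1" "x $ 1 + 2 * x $ 2 = x $ 2"
    using arg_cong[OF assms, of "\<lambda>y. y $ 1"] arg_cong[OF assms, of "\<lambda>y. y $ 2"]
    unfolding cat_map_def mult_mod_def cat_matrix_def matrix_vector_mult_def
    by (simp_all only: vec_lambda_beta vector_2 sum_2 of_int_1 of_int_numeral mult_1_left)
  then have "x $ 2 = 0" "x $ 1 = 0" by simp_all
  then show ?thesis by (simp add: vec_eq_iff forall_2)
qed

text \<open>A bijection and its inverse have the same fixed points; the transfer operator iterates
  the inverse.\<close>

lemma inv_cat_map_fixed_point:
  fixes x :: "'n::nontriv torus"
  assumes "mult_mod (matrix_inv cat_matrix) x = x"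
  shows "x = 0"
  using assms bij_cat_map
  by (metis cat_map_fixed_point inv_cat_map bij_inv_eq_iff)

lemma u_tilde_eq_visit_sum:
  assumes "0 < a" "a < 1"
  shows "u_tilde a x = of_real (visit_sum (mult_mod (matrix_inv cat_matrix)) a x x)"
  by (simp add: u_tilde_def resolvent_def
      matrix_inv_unique_right(2)[OF transfer_neumann_right_inverse[OF assms]])

lemma u_tilde_zero:
  assumes "0 < a" "a < 1"
  shows "u_tilde a 0 = of_real (1 / (1 - a))"
  using assms by (simp only: u_tilde_eq_visit_sum) (simp add: visit_sum_fixed_point mult_mod_def)

text \<open>Invertibility makes \<open>matrix_inv\<close> the true inverse, and realness lets real
  parts express the inequality. The difference of the two fractions is \<alpha> / (1 - \<alpha>^2),
  hence the numerator \<alpha> (1 - \<alpha>); with \<alpha> (1 + \<alpha>) the quotient would be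
  \<alpha> / (1 - \<alpha>)^2, a different value.\<close>

theorem theorem4p12:
  fixes \<alpha> :: real
  assumes "0 < \<alpha>" and "\<alpha> < 1"
  shows "invertible (mat 1 - \<alpha> *\<^sub>R (transfer_matrix :: complex ^ 'n::nontriv torus ^ 'n torus))
    \<and> (\<forall>x :: 'n torus. u_tilde \<alpha> x \<in> \<real>)
    \<and> (\<forall>x :: 'n torus. x \<noteq> 0 \<longrightarrow>
          Re (u_tilde \<alpha> 0 - u_tilde \<alpha> x) \<ge> 1 / (1 - \<alpha>) - 1 / (1 - \<alpha>\<^sup>2))
    \<and> 1 / (1 - \<alpha>) - 1 / (1 - \<alpha>\<^sup>2) = \<alpha> * (1 - \<alpha>) / ((1 - \<alpha>) * (1 - \<alpha>\<^sup>2))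
    \<and> filterlim (\<lambda>a::real. a * (1 - a) / ((1 - a) * (1 - a\<^sup>2))) at_top (at_left 1)"
proof (intro conjI allI impI)
  let ?\<sigma> = "mult_mod (matrix_inv cat_matrix) :: 'n torus \<Rightarrow> _"
  show "invertible (mat 1 - \<alpha> *\<^sub>R (transfer_matrix :: complex ^ 'n torus ^ 'n torus))"
    by (rule matrix_inv_unique_right[OF transfer_neumann_right_inverse[OF assms]])
  note u = u_tilde_eq_visit_sum[OF assms]
  show "u_tilde \<alpha> x \<in> \<real>" for x :: "'n torus"
    by (simp add: u)
  \<comment> \<open>The point \<open>0\<close> has no type annotation in the theorem, so it may belong to another modulus;
    its diagonal entry is the same for every modulus.\<close>
  show "Re (u_tilde \<alpha> 0 - u_tilde \<alpha> x) \<ge> 1 / (1 - \<alpha>) - 1 / (1 - \<alpha>\<^sup>2)"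
    if "x \<noteq> 0" for x :: "'n torus"
  proof -
    have "?\<sigma> x \<noteq> x" using inv_cat_map_fixed_point that by blast
    then show ?thesis
      using visit_sum_not_fixed_point[OF assms, of ?\<sigma> x]
      by (simp only: u_tilde_zero[OF assms] u[of x] minus_complex.sel Re_complex_of_real) simp
  qed
  have sq: "1 - \<alpha>\<^sup>2 = (1 - \<alpha>) * (1 + \<alpha>)"
    by (simp add: power2_eq_square algebra_simps)
  show "1 / (1 - \<alpha>) - 1 / (1 - \<alpha>\<^sup>2) = \<alpha> * (1 - \<alpha>) / ((1 - \<alpha>) * (1 - \<alpha>\<^sup>2))"
    unfolding sq using assms by (simp add: divide_simps)
  \<comment> \<open>Left of 1 the quotient is a / (1 - a^2): the numerator tends to 1, the
    denominator to 0 from above.\<close>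
  show "filterlim (\<lambda>a::real. a * (1 - a) / ((1 - a) * (1 - a\<^sup>2))) at_top (at_left 1)"
    by real_asymp
qed

end
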